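(* Let $L$ be a modular lattice sectionally of finite height, with height function $h$, and let $\delta_h\colon L\rightarrow \mathbb{R}_{\geq 0}$ be given by $$\delta_h(a)=\begin{cases} 0, & a=0,\\ h(a)-1, & \text{otherwise.}\end{cases}$$ Then $(L,\delta_h)$ is a strictly monotone lattice diversity.
   Context: In a lattice $L$ with least element $0$, the atoms are the elements $a$ that cover $0$, i.e. $a>0$ and there is no $c\in L$ with $0<c<a$; $A(L)$ is the set of atoms. Lattice diversity: let $L$ be a lattice with least element $0$ and let $\delta\colon L\to\mathbb{R}_{\ge 0}$. The pair $(L,\delta)$ is a lattice diversity if for all $a,b\in L$: (1) $\delta(a)=0$ if and only if $a\in A(L)$ or $a=0$; (2) $a\le b$ implies $\delta(a)\le\delta(b)$; (3) $a\wedge b\ne 0$ implies $\delta(a\vee b)\le\delta(a)+\delta(b)$. A lattice diversity $(L,\delta)$ is strictly monotone if $a<b$ implies $\delta(a)<\delta(b)$ for all $a,b\neq 0$. A lattice $L$ is modular if for all $a,b,c\in L$, $c\le a$ implies $a\wedge(b\vee c)=(a\wedge b)\vee c$. The length of a chain of $n+1$ elements is $n$. A lattice is of finite height if there is an upper bound on the lengths of its chains; its height is the least such upper bound. For $a\le b$ put $I[a,b]=\{c\in L\mid a\le c\le b\}$. $L$ is sectionally of finite height if it has a least element $0$ and for every $a\in L$ the interval $I[0,a]$ is of finite height; the height of $I[0,a]$ is then denoted $h(a)$. *)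

theory Defs
  imports Complex_Main
begin

text \<open>
  The lattice is the universe of a type; its least element 0 is \<^const>\<open>bot\<close>. The join and the
  meet are \<^const>\<open>sup\<close> and \<^const>\<open>inf\<close>.
\<close>

definition atoms :: "'a::bounded_lattice_bot set" where
  "atoms = {a. bot < a \<and> \<not> (\<exists>c. bot < c \<and> c < a)}"

definition lattice_diversity :: "('a::bounded_lattice_bot \<Rightarrow> real) \<Rightarrow> bool" where
  "lattice_diversity \<delta> \<longleftrightarrow>
     (\<forall>a. 0 \<le> \<delta> a) \<and>
     (\<forall>a. \<delta> a = 0 \<longleftrightarrow> a \<in> atoms \<or> a = bot) \<and>
     (\<forall>a b. a \<le> b \<longrightarrow> \<delta> a \<le> \<delta> b) \<and>
     (\<forall>a b. inf a b \<noteq> bot \<longrightarrow> \<delta> (sup a b) \<le> \<delta> a + \<delta> b)"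

definition strictly_monotone :: "('a::bounded_lattice_bot \<Rightarrow> real) \<Rightarrow> bool" where
  "strictly_monotone \<delta> \<longleftrightarrow>
     (\<forall>a b. a \<noteq> bot \<longrightarrow> b \<noteq> bot \<longrightarrow> a < b \<longrightarrow> \<delta> a < \<delta> b)"

definition modular_lattice :: "'a::lattice itself \<Rightarrow> bool" where
  "modular_lattice _ \<longleftrightarrow>
     (\<forall>a b c :: 'a. c \<le> a \<longrightarrow> inf a (sup b c) = sup (inf a b) c)"

text \<open>
  A chain with \<open>n + 1\<close> elements has length \<open>n\<close>. The finiteness conjunct is needed because
  \<^const>\<open>card\<close> is 0 on infinite sets.
\<close>

definition chain_length_bound :: "'a::order set \<Rightarrow> nat \<Rightarrow> bool" where
  "chain_length_bound S n \<longleftrightarrow>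
     (\<forall>C. C \<subseteq> S \<and> Complete_Partial_Order.chain (\<le>) C \<longrightarrow> finite C \<and> card C \<le> n + 1)"

definition finite_height :: "'a::order set \<Rightarrow> bool" where
  "finite_height S \<longleftrightarrow> (\<exists>n. chain_length_bound S n)"

definition height :: "'a::order set \<Rightarrow> nat" where
  "height S = (LEAST n. chain_length_bound S n)"

definition sectionally_finite_height :: "'a::bounded_lattice_bot itself \<Rightarrow> bool" where
  "sectionally_finite_height _ \<longleftrightarrow> (\<forall>a::'a. finite_height {bot..a})"

definition h :: "'a::bounded_lattice_bot \<Rightarrow> nat" where
  "h a = height {bot..a}"

definition \<delta>\<^sub>h :: "'a::bounded_lattice_bot \<Rightarrow> real" where
  "\<delta>\<^sub>h a = (if a = bot then 0 else real (h a) - 1)"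

end

theory Submission
  imports Defs
begin

text \<open>
  Everything but the triangle inequality follows from \<open>h bot = 0\<close>, strict monotonicity of the
  height \<open>h\<close>, and the fact that an atom has only itself and \<open>bot\<close> below it. The triangle
  inequality follows from the submodular law \<open>h (sup a b) + h (inf a b) \<le> h a + h b\<close>
  (\<open>h_submodular\<close>): if \<open>inf a b\<close> is not the least element, it has height at least 1, and
  \<open>(h a - 1) + (h b - 1)\<close> falls short of \<open>h a + h b\<close> by just one more than \<open>h (sup a b) - 1\<close>
  falls short of \<open>h (sup a b)\<close>.

  The submodular law is proved without refining or comparing maximal chains. In a modular lattice
  an element \<open>c\<close> is determined, among the elements comparable to it, by \<open>inf c b\<close> and \<open>sup c b\<close>
  (\<open>modular_cancel\<close>), and between \<open>b\<close> and \<open>sup a b\<close> an element is determined by its meet with \<open>a\<close>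
  (\<open>modular_transpose\<close>). So \<open>c \<mapsto> h (inf c b) + h (inf (sup c b) a)\<close> is strictly increasing below
  \<open>sup a b\<close>. It takes the value \<open>h (inf a b)\<close> at the bottom and \<open>h a + h b\<close> at the top, and a
  chain can be no longer than the range of values of a strictly increasing integer function on it.
\<close>

section \<open>Height\<close>

lemma h_le_if_chain_length_bound:
  "chain_length_bound {bot..a} n \<Longrightarrow> h a \<le> n"
  unfolding h_def height_def by (rule Least_le)

lemma chain_length_bound_h:
  fixes a :: "'a::bounded_lattice_bot"
  assumes "sectionally_finite_height TYPE('a)"
  shows "chain_length_bound {bot..a} (h a)"
  using assms
  unfolding sectionally_finite_height_def finite_height_def h_def height_def
  by (blast intro: LeastI_ex)

text \<open>
  A strictly increasing function is injective on chains. This reduces an upper bound on a height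
  to the construction of one integer-valued function.
\<close>

lemma chain_length_bound_if_strictly_increasing:
  fixes S :: "'a::order set" and f :: "'a \<Rightarrow> nat"
  assumes strict: "\<And>x y. x \<in> S \<Longrightarrow> y \<in> S \<Longrightarrow> x < y \<Longrightarrow> f x < f y"
    and range: "f ` S \<subseteq> {m..n}"
  shows "chain_length_bound S (n - m)"
  unfolding chain_length_bound_def
proof (intro allI impI)
  fix C assume C: "C \<subseteq> S \<and> Complete_Partial_Order.chain (\<le>) C"
  have "inj_on f C"
  proof (rule inj_onI)
    fix x y assume xy: "x \<in> C" "y \<in> C" "f x = f y"
    then have "x \<le> y \<or> y \<le> x" using C by (auto simp: chain_def)
    then show "x = y" using xy C strict[of x y] strict[of y x]
      by (auto simp: order_le_less)
  qed
  moreover have "f ` C \<subseteq> {m..n}" using C range by blast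
  ultimately have "finite C" "card C \<le> card {m..n}"
    by (rule inj_on_finite card_inj_on_le, simp)+
  then show "finite C \<and> card C \<le> n - m + 1" by auto
qed

lemma h_bot: "h (bot :: 'a::bounded_lattice_bot) = 0"
proof -
  have "chain_length_bound {bot..bot::'a} (0 - 0)"
    by (rule chain_length_bound_if_strictly_increasing[of _ "\<lambda>_. 0"]) auto
  then show ?thesis using h_le_if_chain_length_bound by fastforce
qed

text \<open>A chain below \<open>a\<close> can be lengthened by the larger element \<open>b\<close>.\<close>

lemma h_strict_mono:
  fixes a b :: "'a::bounded_lattice_bot"
  assumes fin: "sectionally_finite_height TYPE('a)" and "a < b"
  shows "h a < h b"
proof -
  have longer: "finite C \<and> card C \<le> h b"
    if C: "C \<subseteq> {bot..a}" "Complete_Partial_Order.chain (\<le>) C" for C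
  proof -
    have "b \<notin> C" using C(1) \<open>a < b\<close> by auto
    have sub: "insert b C \<subseteq> {bot..b}" using C(1) \<open>a < b\<close> by auto
    have "\<forall>c\<in>C. c \<le> b" using C(1) \<open>a < b\<close> by auto
    then have chain: "Complete_Partial_Order.chain (\<le>) (insert b C)"
      using C(2) by (auto simp: chain_def)
    have "finite (insert b C) \<and> card (insert b C) \<le> h b + 1"
      using chain_length_bound_h[OF fin, of b, unfolded chain_length_bound_def,
          rule_format, OF conjI[OF sub chain]] .
    then show ?thesis using \<open>b \<notin> C\<close> by auto
  qed
  have "0 < h b" using longer[of "{bot}"] by (simp add: chain_def)
  with longer have "chain_length_bound {bot..a} (h b - 1)"
    unfolding chain_length_bound_def by simp
  then have "h a \<le> h b - 1" by (rule h_le_if_chain_length_bound)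
  with \<open>0 < h b\<close> show ?thesis by simp
qed

lemma h_mono:
  fixes a b :: "'a::bounded_lattice_bot"
  assumes "sectionally_finite_height TYPE('a)" and "a \<le> b"
  shows "h a \<le> h b"
  using assms h_strict_mono[of a b] by (auto simp: order_le_less)

lemma h_pos:
  fixes a :: "'a::bounded_lattice_bot"
  assumes "sectionally_finite_height TYPE('a)" and "a \<noteq> bot"
  shows "0 < h a"
  using h_strict_mono[of bot a] assms by (simp add: h_bot bot.not_eq_extremum)

lemma h_eq_1_iff_atom:
  fixes a :: "'a::bounded_lattice_bot"
  assumes fin: "sectionally_finite_height TYPE('a)" and "a \<noteq> bot"
  shows "h a = 1 \<longleftrightarrow> a \<in> atoms"
proof
  assume "h a = 1"
  then have "\<not> (bot < c \<and> c < a)" for c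
    using h_strict_mono[OF fin, of bot c] h_strict_mono[OF fin, of c a] by auto
  then show "a \<in> atoms" using \<open>a \<noteq> bot\<close> by (simp add: atoms_def bot.not_eq_extremum)
next
  assume atom: "a \<in> atoms"
  \<comment> \<open>The interval below an atom is \<open>{bot, a}\<close>, so the indicator of \<open>a\<close> is strictly increasing.\<close>
  have "chain_length_bound {bot..a} (1 - 0)"
  proof (rule chain_length_bound_if_strictly_increasing)
    show "(if x = bot then 0 else 1) < (if y = bot then 0 else 1::nat)"
      if "x \<in> {bot..a}" "y \<in> {bot..a}" "x < y" for x y
    proof -
      have "x < a" using that by (auto intro: less_le_trans)
      have "\<not> bot < x" using atom \<open>x < a\<close> by (auto simp: atoms_def)
      then have "x = bot" using bot.not_eq_extremum[of x] by blast
      then show ?thesis using \<open>x < y\<close> by auto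
    qed
  qed auto
  then have "h a \<le> 1" using h_le_if_chain_length_bound by fastforce
  then show "h a = 1" using h_pos[OF assms] by simp
qed

section \<open>Submodularity of the height\<close>

text \<open>
  Modularity turns \<open>d\<close>, the meet of \<open>d\<close> with \<open>sup d b = sup b c\<close>, into the join of \<open>c\<close> with
  \<open>inf d b = inf c b\<close>, which is below \<open>c\<close>.
\<close>

lemma modular_cancel:
  fixes b c d :: "'a::lattice"
  assumes "modular_lattice TYPE('a)" and "c \<le> d"
    and "inf c b = inf d b" and "sup c b = sup d b"
  shows "c = d"
proof -
  have "d = inf d (sup b c)" by (metis assms(4) inf_sup_absorb sup_commute)
  also have "\<dots> = sup (inf d b) c" using assms(1,2) by (auto simp: modular_lattice_def)
  also have "\<dots> = c" using assms(3) by (metis inf_le1 sup.absorb2)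
  finally show ?thesis by simp
qed

text \<open>
  One half of Dedekind's transposition principle: meeting with \<open>a\<close> embeds the interval from \<open>b\<close>
  to \<open>sup a b\<close> into the one from \<open>inf a b\<close> to \<open>a\<close>, since joining with \<open>b\<close> recovers the element.
\<close>

lemma modular_transpose:
  fixes a b x :: "'a::lattice"
  assumes "modular_lattice TYPE('a)" and "b \<le> x" and "x \<le> sup a b"
  shows "sup (inf x a) b = x"
proof -
  have "sup (inf x a) b = inf x (sup a b)" using assms(1,2) by (auto simp: modular_lattice_def)
  then show ?thesis using assms(3) by (simp add: inf.absorb1)
qed

lemma h_submodular:
  fixes a b :: "'a::bounded_lattice_bot"
  assumes modular: "modular_lattice TYPE('a)" and fin: "sectionally_finite_height TYPE('a)"
  shows "h (sup a b) + h (inf a b) \<le> h a + h b"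
proof -
  \<comment> \<open>If \<open>c\<close> grows, then its part below \<open>b\<close> grows or its part above \<open>b\<close> does; the latter part is
    transposed below \<open>a\<close>, so that its growth is measured by \<open>h\<close> on the interval below \<open>a\<close>.\<close>
  define f where "f c = h (inf c b) + h (inf (sup c b) a)" for c
  have "chain_length_bound {bot..sup a b} (h a + h b - h (inf a b))"
  proof (rule chain_length_bound_if_strictly_increasing)
    fix c d assume cd: "c \<in> {bot..sup a b}" "d \<in> {bot..sup a b}" "c < d"
    have le: "inf c b \<le> inf d b" "inf (sup c b) a \<le> inf (sup d b) a"
      by (intro inf_mono sup_mono order_refl less_imp_le[OF \<open>c < d\<close>])+
    have "inf c b \<noteq> inf d b \<or> inf (sup c b) a \<noteq> inf (sup d b) a"
    proof (rule ccontr)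
      assume "\<not> ?thesis"
      then have eq: "inf c b = inf d b" "inf (sup c b) a = inf (sup d b) a" by auto
      have "sup c b = sup d b"
        using modular_transpose[OF modular, of b "sup c b" a]
          modular_transpose[OF modular, of b "sup d b" a] cd eq(2) by simp
      then show False using modular_cancel[OF modular less_imp_le[OF \<open>c < d\<close>] eq(1)] \<open>c < d\<close> by simp
    qed
    then show "f c < f d"
      using le h_mono[OF fin le(1)] h_mono[OF fin le(2)]
        h_strict_mono[OF fin, of "inf c b" "inf d b"]
        h_strict_mono[OF fin, of "inf (sup c b) a" "inf (sup d b) a"]
      unfolding f_def by (auto simp: order_le_less)
  next
    show "f ` {bot..sup a b} \<subseteq> {h (inf a b)..h a + h b}"
    proof
      fix n assume "n \<in> f ` {bot..sup a b}"
      then obtain c where n: "n = f c" by auto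
      have "h (inf a b) \<le> h (inf (sup c b) a)"
        by (rule h_mono[OF fin]) (simp add: le_infI2)
      moreover have "h (inf c b) \<le> h b" "h (inf (sup c b) a) \<le> h a"
        by (auto intro: h_mono[OF fin])
      ultimately show "n \<in> {h (inf a b)..h a + h b}" by (simp add: n f_def)
    qed
  qed
  then have "h (sup a b) \<le> h a + h b - h (inf a b)" by (rule h_le_if_chain_length_bound)
  moreover have "h (inf a b) \<le> h a" by (rule h_mono[OF fin]) simp
  ultimately show ?thesis by simp
qed

section \<open>The diversity of a modular lattice\<close>

theorem theorem6:
  assumes "modular_lattice TYPE('a::bounded_lattice_bot)"
    and "sectionally_finite_height TYPE('a)"
  shows "lattice_diversity (\<delta>\<^sub>h :: 'a \<Rightarrow> real) \<and> strictly_monotone (\<delta>\<^sub>h :: 'a \<Rightarrow> real)"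
proof
  note pos = h_pos[OF assms(2)]
  have ge1: "1 \<le> real (h a)" if "a \<noteq> bot" for a :: 'a
    using pos[OF that] by simp
  show "strictly_monotone (\<delta>\<^sub>h :: 'a \<Rightarrow> real)"
    using h_strict_mono[OF assms(2)] by (simp add: strictly_monotone_def \<delta>\<^sub>h_def)
  have nonneg: "0 \<le> \<delta>\<^sub>h a" for a :: 'a
    using ge1[of a] by (simp add: \<delta>\<^sub>h_def)
  have zero: "\<delta>\<^sub>h a = 0 \<longleftrightarrow> a \<in> atoms \<or> a = bot" for a :: 'a
    using h_eq_1_iff_atom[OF assms(2), of a] by (auto simp: \<delta>\<^sub>h_def)
  have mono: "\<delta>\<^sub>h a \<le> \<delta>\<^sub>h b" if "a \<le> b" for a b :: 'a
  proof (cases "a = bot")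
    case True
    then show ?thesis using nonneg[of b] by (simp add: \<delta>\<^sub>h_def)
  next
    case False
    then have "b \<noteq> bot" using that by (auto simp: bot_unique)
    then show ?thesis using False h_mono[OF assms(2) that] by (simp add: \<delta>\<^sub>h_def)
  qed
  have triangle: "\<delta>\<^sub>h (sup a b) \<le> \<delta>\<^sub>h a + \<delta>\<^sub>h b" if "inf a b \<noteq> bot" for a b :: 'a
  proof -
    have "a \<noteq> bot" "b \<noteq> bot" "sup a b \<noteq> bot" using that by auto
    moreover have "real (h (sup a b)) + real (h (inf a b)) \<le> real (h a) + real (h b)"
      using h_submodular[OF assms, of a b] by linarith
    ultimately show ?thesis using ge1[OF that] by (simp add: \<delta>\<^sub>h_def)
  qed
  show "lattice_diversity (\<delta>\<^sub>h :: 'a \<Rightarrow> real)"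
    unfolding lattice_diversity_def using nonneg zero mono triangle by blast
qed

end
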